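(* Let $G$ be any connected bridgeless $(n,m)$-graph with $m\geqslant n$ (loops and multiple edges allowed), and write its flow polynomial as $F(G,t)=\sum_{i=0}^{m-n+1}c_i t^i$. Then $|c_i|\leqslant d_i$ for all $0\leqslant i\leqslant m-n+1$, where the numbers $d_i$ are defined by $$\sum_{i=0}^{m-n+1}d_i t^i=\begin{cases}\prod_{j=1}^{m-n+1}(t+j) & \text{if } n\leqslant m\leqslant n+3,\\ (t+1)(t+2)(t+3)^2(t+4)^{m-n-3} & \text{if } m\geqslant n+4.\end{cases}$$
   Context: All graphs are finite and may have loops and multiple edges. An $(n,m)$-graph is a graph with $n$ vertices and $m$ edges. The flow polynomial of an $(n,m)$-graph $G$ is $$F(G,t)=\sum_{Z\subseteq E(G)}(-1)^{m-|Z|}\,t^{|Z|+c(Z)-n},$$ where $c(Z)$ is the number of connected components of the spanning subgraph of $G$ with vertex set $V(G)$ and edge set $Z$. For connected bridgeless $G$ it is a polynomial in $t$ of degree $m-n+1$. *)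

theory Defs
  imports "HOL-Computational_Algebra.Polynomial"
begin

text \<open>
  Undirected graphs with loops and multiple edges: \<open>ends G e\<close> is the set of endpoints of the
  edge \<open>e\<close>, a one-element set exactly when \<open>e\<close> is a loop.
\<close>

record ('v, 'e) multigraph =
  verts :: "'v set"
  edges :: "'e set"
  ends  :: "'e \<Rightarrow> 'v set"

definition fin_multigraph :: "('v, 'e) multigraph \<Rightarrow> bool" where
  "fin_multigraph G \<longleftrightarrow>
     finite (verts G) \<and> finite (edges G) \<and>
     (\<forall>e \<in> edges G. ends G e \<subseteq> verts G \<and> card (ends G e) \<in> {1, 2})"

definition adj_rel :: "('v, 'e) multigraph \<Rightarrow> 'e set \<Rightarrow> ('v \<times> 'v) set" where
  "adj_rel G Z = {(u, v). \<exists>e \<in> Z. ends G e = {u, v}}"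

definition conn_rel :: "('v, 'e) multigraph \<Rightarrow> 'e set \<Rightarrow> ('v \<times> 'v) set" where
  "conn_rel G Z = {(u, v). u \<in> verts G \<and> v \<in> verts G \<and> (u, v) \<in> (adj_rel G Z)\<^sup>*}"

lemma equiv_conn_rel:
  assumes "fin_multigraph G"
  shows "equiv (verts G) (conn_rel G Z)"
proof (rule equivI)
  have "sym (adj_rel G Z)"
    unfolding adj_rel_def by (rule symI) (auto simp: insert_commute)
  then have "sym ((adj_rel G Z)\<^sup>*)"
    by (rule sym_rtrancl)
  then show "sym (conn_rel G Z)"
    unfolding conn_rel_def sym_def by blast
  show "refl_on (verts G) (conn_rel G Z)"
    by (auto simp: conn_rel_def refl_on_def)
  show "trans (conn_rel G Z)"
    by (rule transI) (auto simp: conn_rel_def)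
  show "conn_rel G Z \<subseteq> verts G \<times> verts G"
    by (auto simp: conn_rel_def)
qed

definition num_components :: "('v, 'e) multigraph \<Rightarrow> 'e set \<Rightarrow> nat" where
  "num_components G Z = card (verts G // conn_rel G Z)"

text \<open>The graph without vertices does not count as connected.\<close>

definition connected_graph :: "('v, 'e) multigraph \<Rightarrow> bool" where
  "connected_graph G \<longleftrightarrow>
     verts G \<noteq> {} \<and> (\<forall>u \<in> verts G. \<forall>v \<in> verts G. (u, v) \<in> conn_rel G (edges G))"

definition is_bridge :: "('v, 'e) multigraph \<Rightarrow> 'e \<Rightarrow> bool" where
  "is_bridge G e \<longleftrightarrow>
     e \<in> edges G \<and> num_components G (edges G - {e}) > num_components G (edges G)"

definition bridgeless :: "('v, 'e) multigraph \<Rightarrow> bool" where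
  "bridgeless G \<longleftrightarrow> (\<forall>e \<in> edges G. \<not> is_bridge G e)"

text \<open>
  The subtractions on naturals are exact: \<open>Z\<close> ranges over subsets of the edge set, and
  \<open>card Z + num_components G Z \<ge> card (verts G)\<close> since adding one edge merges at most two
  components.
\<close>

definition flow_poly :: "('v, 'e) multigraph \<Rightarrow> int poly" where
  "flow_poly G =
     (\<Sum>Z \<in> Pow (edges G).
        monom ((-1) ^ (card (edges G) - card Z))
              (card Z + num_components G Z - card (verts G)))"

text \<open>\<open>[:a, 1:]\<close> is the linear polynomial $t + a$; used only for \<open>m \<ge> n\<close>.\<close>

definition bound_poly :: "nat \<Rightarrow> nat \<Rightarrow> int poly" where
  "bound_poly n m =
     (if m \<le> n + 3 then (\<Prod>j = 1..m - n + 1. [:int j, 1:])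
      else [:1, 1:] * [:2, 1:] * [:3, 1:] ^ 2 * [:4, 1:] ^ (m - n - 3))"

end

theory Submission imports Defs
begin

text \<open>
  The proof is a deletion-contraction induction that always works at one vertex \<open>v\<close> and remembers
  only two numbers: the rank \<open>r = m - n + 1\<close> and the degree \<open>a\<close> of \<open>v\<close>.  For a link \<open>e\<close> from \<open>v\<close> to
  \<open>u\<close> that is not a bridge, \<open>F(G) = F(G/e) - F(G-e)\<close>.  Deletion lowers both \<open>r\<close> and \<open>a\<close> by one;
  contraction keeps \<open>r\<close> and changes the degree of \<open>v\<close> to \<open>a + deg u - 2\<close>, which is at least \<open>a + 1\<close>
  unless \<open>deg u = 2\<close>.  In that exceptional case \<open>G - e\<close> has a vertex of degree one, hence a bridge,
  so that \<open>F(G-e) = 0\<close> and \<open>F(G) = F(G/e)\<close> with the degree of \<open>v\<close> unchanged.  A loop at \<open>v\<close>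
  splits off a factor \<open>t - 1\<close> and changes \<open>(r, a)\<close> to \<open>(r - 1, a - 2)\<close>.  As a bridge makes the
  flow polynomial vanish, the induction may run over all connected graphs.  It
  shows that the coefficients of \<open>F(G)\<close> are bounded in absolute value by those of a polynomial
  \<open>B r a\<close> with
  \[ B\,r\,a = B\,(r-1)\,(a-1) + B\,r\,(a+1), \qquad B\,r\,(2r) = (t+1)^r, \]
  the first for \<open>2 \<le> a < 2r\<close>, and the second coming from the bouquet of \<open>r\<close> loops (lemma \<open>flow_poly_dominated\<close>).

  It remains to study this triangular table of polynomials.  Its largest entry in row \<open>r\<close> is
  \<open>B r 2\<close>, which for \<open>r \<le> 5\<close> can be calculated.  From then on one more unit of rank costs at most a
  factor \<open>t + 4\<close>: the inequality between \<open>B (r+1) a\<close> and \<open>(t+4) * B r a\<close> is passed on by the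
  recursion, so that only the boundary \<open>a = 2r\<close> has to be examined, where for \<open>r \<ge> 2\<close> it reads
  \<open>(t+1)^(r-1) * (t+2)^2 \<le> (t+4) * (t+1)^r\<close> and follows from \<open>t^2 + 4t + 4 \<le> t^2 + 5t + 4\<close>
  (lemma \<open>flow_bound_rank_growth\<close>).
\<close>

section \<open>Coefficientwise domination of integer polynomials\<close>

text \<open>
  One relation serves both for signed polynomials against a bound and for comparing two bounds.  The
  right-hand side is forced to have nonnegative coefficients, so \<open>q \<preceq> q\<close> expresses just that.
\<close>
definition dominated :: "int poly \<Rightarrow> int poly \<Rightarrow> bool"  (infix "\<preceq>" 50) where
  "p \<preceq> q \<longleftrightarrow> (\<forall>i. \<bar>coeff p i\<bar> \<le> coeff q i)"

lemma dominated_trans [trans]: "p \<preceq> q \<Longrightarrow> q \<preceq> s \<Longrightarrow> p \<preceq> s"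
  unfolding dominated_def by (meson abs_ge_self order_trans)

lemma dominated_refl_right: "p \<preceq> q \<Longrightarrow> q \<preceq> q"
  unfolding dominated_def by (smt (verit))

lemma zero_dominated: "q \<preceq> q \<Longrightarrow> 0 \<preceq> q"
  unfolding dominated_def by (simp add: abs_le_iff)

lemma dominated_zero_iff: "p \<preceq> 0 \<longleftrightarrow> p = 0"
  by (auto simp: dominated_def poly_eq_iff)

lemma dominated_add: "p \<preceq> q \<Longrightarrow> p' \<preceq> q' \<Longrightarrow> p + p' \<preceq> q + q'"
  unfolding dominated_def by (auto intro: order_trans[OF abs_triangle_ineq] add_mono)

lemma dominated_diff: "p \<preceq> q \<Longrightarrow> p' \<preceq> q' \<Longrightarrow> p - p' \<preceq> q + q'"
  unfolding dominated_def by (auto intro: order_trans[OF abs_triangle_ineq4] add_mono)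

lemma dominated_mult:
  assumes "p \<preceq> q" "p' \<preceq> q'"
  shows "p * p' \<preceq> q * q'"
  unfolding dominated_def
proof
  fix i
  have "\<bar>coeff (p * p') i\<bar> \<le> (\<Sum>j\<le>i. \<bar>coeff p j * coeff p' (i - j)\<bar>)"
    unfolding coeff_mult by (rule sum_abs)
  also have "\<dots> \<le> (\<Sum>j\<le>i. coeff q j * coeff q' (i - j))"
    using assms unfolding dominated_def
    by (intro sum_mono) (simp add: abs_mult mult_mono')
  finally show "\<bar>coeff (p * p') i\<bar> \<le> coeff (q * q') i"
    unfolding coeff_mult .
qed

lemma dominated_pCons: "\<bar>a\<bar> \<le> b \<Longrightarrow> p \<preceq> q \<Longrightarrow> pCons a p \<preceq> pCons b q"
  by (auto simp: dominated_def coeff_pCons split: nat.split)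

lemma dominated_zero_zero: "0 \<preceq> 0"
  by (simp add: dominated_def)

lemmas dominated_explicit = dominated_pCons dominated_zero_zero

lemma dominated_power_self: "p \<preceq> p \<Longrightarrow> p ^ k \<preceq> p ^ k"
  by (induction k) (auto intro: dominated_mult dominated_explicit simp: one_pCons)

section \<open>The table of bounds by rank and degree\<close>

text \<open>
  The entry \<open>flow_bound r a\<close> bounds the flow polynomial of a connected graph of rank \<open>r\<close> that has
  a vertex of degree \<open>a\<close>.  It is zero at \<open>a = 1\<close>, where the only edge at the vertex is a bridge, and
  at the pairs which no connected bridgeless graph realises: \<open>a > 2 * r\<close>, and \<open>a = 0\<close> with positive \<open>r\<close>.
\<close>
function flow_bound :: "nat \<Rightarrow> nat \<Rightarrow> int poly" where
  "flow_bound r a =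
     (if a = 2 * r then [:1, 1:] ^ r
      else if 2 \<le> a \<and> a < 2 * r then flow_bound (r - 1) (a - 1) + flow_bound r (a + 1)
      else 0)"
  by auto
termination by (relation "Wellfounded.measure (\<lambda>(r, a). 2 * r - a)") auto

declare flow_bound.simps [simp del]

lemma flow_bound_top: "flow_bound r (2 * r) = [:1, 1:] ^ r"
  by (simp add: flow_bound.simps)

lemma flow_bound_rec:
  "2 \<le> a \<Longrightarrow> a < 2 * r \<Longrightarrow> flow_bound r a = flow_bound (r - 1) (a - 1) + flow_bound r (a + 1)"
  by (simp add: flow_bound.simps)

lemma flow_bound_above: "2 * r < a \<Longrightarrow> flow_bound r a = 0"
  by (simp add: flow_bound.simps)

lemma flow_bound_1: "flow_bound r 1 = 0"
  by (simp add: flow_bound.simps)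

lemma flow_bound_outside: "a \<noteq> 2 * r \<Longrightarrow> \<not> (2 \<le> a \<and> a < 2 * r) \<Longrightarrow> flow_bound r a = 0"
  by (subst flow_bound.simps) auto

lemma flow_bound_nonneg: "flow_bound r a \<preceq> flow_bound r a"
proof (induction r a rule: flow_bound.induct)
  case (1 r a)
  consider "a = 2 * r" | "2 \<le> a" "a < 2 * r" | "a \<noteq> 2 * r" "\<not> (2 \<le> a \<and> a < 2 * r)" by blast
  then show ?case
  proof cases
    case 1
    then show ?thesis by (auto simp: flow_bound_top intro!: dominated_power_self dominated_explicit)
  next
    case 2
    then have "a \<noteq> 2 * r" by simp
    note IH = "1.IH"[OF this conjI[OF 2]]
    show ?thesis
      unfolding flow_bound_rec[OF 2] by (rule dominated_add[OF IH])
  next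
    case 3
    then have "flow_bound r a = 0" by (rule flow_bound_outside)
    then show ?thesis by (simp add: dominated_zero_zero)
  qed
qed

text \<open>
  The form of the recursion that the induction on graphs consumes: as an inequality it also holds
  on and above the line \<open>a = 2 * r\<close>, where both summands vanish, so the induction need not know
  that degrees are at most \<open>2 * r\<close>.
\<close>
lemma flow_bound_step:
  assumes "2 \<le> a"
  shows "flow_bound (r - 1) (a - 1) + flow_bound r (a + 1) \<preceq> flow_bound r a"
proof (cases "a < 2 * r")
  case True
  then show ?thesis using assms by (metis flow_bound_rec flow_bound_nonneg)
next
  case False
  then have "flow_bound (r - 1) (a - 1) = 0" "flow_bound r (a + 1) = 0"
    using assms by (auto intro!: flow_bound_above)
  then show ?thesis by (simp add: zero_dominated flow_bound_nonneg)
qed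

lemma flow_bound_antimono:
  assumes "2 \<le> a" "a \<le> b"
  shows "flow_bound r b \<preceq> flow_bound r a"
  using assms(2)
proof (induction b rule: dec_induct)
  case base
  show ?case by (rule flow_bound_nonneg)
next
  case (step b)
  have "0 + flow_bound r (b + 1) \<preceq> flow_bound (r - 1) (b - 1) + flow_bound r (b + 1)"
    by (intro dominated_add zero_dominated flow_bound_nonneg)
  also have "\<dots> \<preceq> flow_bound r b" using step assms by (intro flow_bound_step) auto
  also note step.IH
  finally show ?case by simp
qed

text \<open>
  Removing a loop at the chosen vertex is compatible with the table.  On the line \<open>a = 2 * r\<close> this is
  an equality, and the recursion carries it to the smaller degrees.
\<close>
lemma flow_bound_loop:
  assumes "2 \<le> a" "1 \<le> r"
  shows "[:1, 1:] * flow_bound (r - 1) (a - 2) \<preceq> flow_bound r a"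
  using assms
proof (induction r a rule: flow_bound.induct)
  case (1 r a)
  consider "a = 2 * r" | "2 * r < a" | "a < 2 * r" "a < 4" | "4 \<le> a" "a < 2 * r" by linarith
  then show ?case
  proof cases
    case 1
    then have *: "a - 2 = 2 * (r - 1)" by simp
    have "[:1, 1:] * flow_bound (r - 1) (a - 2) = [:1, 1:] ^ Suc (r - 1)"
      unfolding * flow_bound_top by simp
    also have "\<dots> = flow_bound r a" using 1 "1.prems" by (simp add: flow_bound_top)
    finally show ?thesis by (simp only: flow_bound_nonneg)
  next
    case 2
    then have "flow_bound (r - 1) (a - 2) = 0" using "1.prems" by (intro flow_bound_above) linarith
    then show ?thesis by (simp add: zero_dominated flow_bound_nonneg)
  next
    case 3
    then have "flow_bound (r - 1) (a - 2) = 0" using "1.prems"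
      by (intro flow_bound_outside) linarith+
    then show ?thesis by (simp add: zero_dominated flow_bound_nonneg)
  next
    case 4
    have e: "a - 2 - 1 = a - 1 - 2" "a - 2 + 1 = a + 1 - 2" using 4 by auto
    have "[:1, 1:] * flow_bound (r - 1) (a - 2) =
      [:1, 1:] * flow_bound (r - 1 - 1) (a - 1 - 2) + [:1, 1:] * flow_bound (r - 1) (a + 1 - 2)"
      using 4 by (subst flow_bound_rec) (auto simp only: e distrib_left)
    also have "\<dots> \<preceq> flow_bound (r - 1) (a - 1) + flow_bound r (a + 1)"
      using 4 by (intro dominated_add "1.IH") auto
    also have "\<dots> \<preceq> flow_bound r a" using 4 by (intro flow_bound_step) auto
    finally show ?thesis .
  qed
qed

lemma flow_bound_below_top:
  assumes "1 \<le> r"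
  shows "flow_bound (r + 1) (2 * r + 1) = [:1, 1:] ^ r * [:2, 1:]"
proof -
  have "flow_bound (r + 1) (2 * r + 1) = flow_bound r (2 * r) + flow_bound (r + 1) (2 * (r + 1))"
    using assms by (subst flow_bound_rec) auto
  also have "\<dots> = [:1, 1:] ^ r * (1 + [:1, 1:])"
    by (simp only: flow_bound_top) (simp add: algebra_simps)
  finally show ?thesis by (simp add: one_pCons)
qed

text \<open>
  The factor \<open>t + 4\<close> of the theorem originates here.  The range stops at \<open>a = 2 * r\<close> since
  for \<open>a = 2 * r + 1\<close> the right-hand side is zero and the left-hand side is not.  The recursion from inside the range
  never leaves it, except to \<open>a = 1\<close>, where both sides are zero.
\<close>
lemma flow_bound_rank_growth:
  assumes "2 \<le> a" "a \<le> 2 * r"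
  shows "flow_bound (r + 1) a \<preceq> [:4, 1:] * flow_bound r a"
  using assms
proof (induction r a rule: flow_bound.induct)
  case (1 r a)
  show ?case
  proof (cases "a = 2 * r")
    case True
    have step: "flow_bound (r + 1) a = flow_bound r (2 * r - 1) + [:1, 1:] ^ r * [:2, 1:]"
      using True "1.prems" flow_bound_below_top[of r] by (subst flow_bound_rec) auto
    show ?thesis
    proof (cases "r = 1")
      case True
      then show ?thesis using step \<open>a = 2 * r\<close> flow_bound_1
        by (simp add: flow_bound_top[of 1, simplified]) (intro dominated_explicit; simp)
    next
      case False
      define s where "s = r - 1"
      have r: "r = s + 1" and s: "1 \<le> s"
        using False True "1.prems" unfolding s_def by linarith+
      have "flow_bound (r + 1) a = [:1, 1:] ^ s * [:4, 4, 1:]"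
      proof -
        have "flow_bound r (2 * r - 1) = [:1, 1:] ^ s * [:2, 1:]"
          using flow_bound_below_top[OF s] r by simp
        then have "flow_bound (r + 1) a = [:1, 1:] ^ s * ([:2, 1:] + [:1, 1:] * [:2, 1:])"
          using step by (simp only: r power_add power_one_right distrib_left mult.assoc)
        then show ?thesis by simp
      qed
      also have "\<dots> \<preceq> [:1, 1:] ^ s * [:4, 5, 1:]"
        by (intro dominated_mult dominated_power_self dominated_explicit) auto
      also have "[:1, 1:] ^ s * [:4, 5, 1:] = [:4, 1:] * flow_bound r a"
      proof -
        have "flow_bound r a = [:1, 1:] ^ s * [:1, 1:]"
          unfolding True flow_bound_top r by simp
        moreover have "[:4, 5, 1:] = [:1, 1:] * [:4, 1 :: int:]" by simp
        ultimately show ?thesis by (simp only: mult_ac)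
      qed
      finally show ?thesis .
    qed
  next
    case False
    with "1.prems" have a: "2 \<le> a" "a < 2 * r" by auto
    have lower: "flow_bound r (a - 1) \<preceq> [:4, 1:] * flow_bound (r - 1) (a - 1)"
    proof (cases "a = 2")
      case True
      then show ?thesis by (simp add: flow_bound_1[simplified] dominated_zero_zero)
    next
      case False
      then have "flow_bound (r - 1 + 1) (a - 1) \<preceq> [:4, 1:] * flow_bound (r - 1) (a - 1)"
        using a by (intro "1.IH"(1)) auto
      then show ?thesis using a by simp
    qed
    have upper: "flow_bound (r + 1) (a + 1) \<preceq> [:4, 1:] * flow_bound r (a + 1)"
      using a by (intro "1.IH"(2)) auto
    have "flow_bound (r + 1) a = flow_bound r (a - 1) + flow_bound (r + 1) (a + 1)"
      using a by (subst flow_bound_rec) auto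
    also have "\<dots> \<preceq> [:4, 1:] * flow_bound (r - 1) (a - 1) + [:4, 1:] * flow_bound r (a + 1)"
      by (intro dominated_add lower upper)
    also have "\<dots> = [:4, 1:] * flow_bound r a"
      using a by (simp only: flow_bound_rec distrib_left)
    finally show ?thesis .
  qed
qed

text \<open>
  Ranks three and four are the flow polynomials of \<open>K\<^sub>4\<close> and of \<open>K\<^sub>3\<^sub>,\<^sub>3\<close>, up to signs; so the
  recursion loses nothing there.
\<close>
lemma flow_bound_small:
  "flow_bound 1 2 = [:1, 1:]"
  "flow_bound 2 2 = [:1, 1:] * [:2, 1:]"
  "flow_bound 3 2 = [:1, 1:] * [:2, 1:] * [:3, 1:]"
  "flow_bound 4 2 = [:1, 1:] * [:2, 1:] * [:10, 6, 1:]"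
  "flow_bound 5 2 = [:1, 1:] * [:2, 1:] * [:35, 29, 9, 1:]"
  by (simp_all add: flow_bound.simps power_numeral_reduce numeral_poly one_pCons)

text \<open>
  The base case compares the cubic factor \<open>t^3 + 9t^2 + 29t + 35\<close> of rank five with
  \<open>(t+3)\<^sup>2(t+4) = t^3 + 10t^2 + 33t + 36\<close>.  The induction cannot start at rank four: the constant term
  10 of the quadratic factor there exceeds the 9 of \<open>(t+3)\<^sup>2\<close>.
\<close>
lemma flow_bound_large:
  "flow_bound (5 + k) 2 \<preceq> [:1, 1:] * [:2, 1:] * [:3, 1:] ^ 2 * [:4, 1:] ^ (k + 1)"
proof (induction k)
  case 0
  show ?case by (simp add: flow_bound_small power2_eq_square) (intro dominated_explicit; simp)
next
  case (Suc k)
  have "flow_bound (5 + k + 1) 2 \<preceq> [:4, 1:] * flow_bound (5 + k) 2"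
    by (rule flow_bound_rank_growth) auto
  also have "\<dots> \<preceq> [:4, 1:] * ([:1, 1:] * [:2, 1:] * [:3, 1:] ^ 2 * [:4, 1:] ^ (k + 1))"
    by (intro dominated_mult Suc dominated_explicit) auto
  also have "\<dots> = [:1, 1:] * [:2, 1:] * [:3, 1:] ^ 2 * [:4, 1:] ^ (Suc k + 1)"
    by (simp only: add_Suc power_Suc mult_ac)
  finally show ?case by (simp only: add_Suc_right Suc_eq_plus1 add.assoc)
qed

lemma flow_bound_le_bound_poly:
  assumes "n \<le> m"
  shows "flow_bound (m + 1 - n) a \<preceq> bound_poly n m"
proof -
  obtain k where m: "m = n + k" using assms le_Suc_ex by blast
  have two: "flow_bound (k + 1) 2 \<preceq> bound_poly n m"
  proof -
    consider "k = 0" | "k = 1" | "k = 2" | "k = 3" | l where "k = l + 4"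
    proof (cases "k < 4")
      case True
      then have "k = 0 \<or> k = 1 \<or> k = 2 \<or> k = 3" by linarith
      then show thesis using that(1-4) by blast
    next
      case False
      then show thesis using that(5)[of "k - 4"] by simp
    qed
    then show ?thesis
    proof cases
      case 1
      then have "k + 1 = 1" by simp
      then show ?thesis using 1
        by (simp only: flow_bound_small, simp add: m bound_poly_def numeral_2_eq_2 numeral_3_eq_3) (intro dominated_explicit; simp)
    next
      case 2
      then have "k + 1 = 2" by simp
      then show ?thesis using 2
        by (simp only: flow_bound_small, simp add: m bound_poly_def numeral_2_eq_2 numeral_3_eq_3) (intro dominated_explicit; simp)
    next
      case 3
      then have "k + 1 = 3" by simp
      then show ?thesis using 3
        by (simp only: flow_bound_small, simp add: m bound_poly_def numeral_2_eq_2 numeral_3_eq_3) (intro dominated_explicit; simp)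
    next
      case 4
      then have "k + 1 = 4" by simp
      then show ?thesis using 4
        by (simp only: flow_bound_small, simp add: m bound_poly_def numeral_2_eq_2 numeral_3_eq_3) (intro dominated_explicit; simp)
    next
      case 5
      have "flow_bound (5 + l) 2 \<preceq> [:1, 1:] * [:2, 1:] * [:3, 1:] ^ 2 * [:4, 1:] ^ (l + 1)"
        by (rule flow_bound_large)
      also have "\<dots> = bound_poly n m" using 5 m by (simp add: bound_poly_def)
      finally show ?thesis using 5 by (simp add: add.commute)
    qed
  qed
  show ?thesis
  proof (cases "2 \<le> a")
    case True
    then have "flow_bound (k + 1) a \<preceq> flow_bound (k + 1) 2" by (rule flow_bound_antimono[OF order.refl])
    then show ?thesis using two dominated_trans by (simp add: m add.commute) 
  next
    case False
    then have "flow_bound (m + 1 - n) a = 0" using m by (intro flow_bound_outside) linarith+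
    then show ?thesis using zero_dominated[OF dominated_refl_right[OF two]] by simp
  qed
qed

section \<open>Deletion, contraction and components\<close>

definition delete_edge :: "('v, 'e) multigraph \<Rightarrow> 'e \<Rightarrow> ('v, 'e) multigraph" where
  "delete_edge G e = G\<lparr>edges := edges G - {e}\<rparr>"

text \<open>
  Contraction of a link \<open>e\<close> from \<open>v\<close> to \<open>u\<close>: the vertex \<open>u\<close> is absorbed by \<open>v\<close>, which keeps its
  name, so that the induction can go on at \<open>v\<close>.  Edges parallel to \<open>e\<close> become loops at \<open>v\<close>.
\<close>
definition contract_edge :: "('v, 'e) multigraph \<Rightarrow> 'e \<Rightarrow> 'v \<Rightarrow> 'v \<Rightarrow> ('v, 'e) multigraph" where
  "contract_edge G e v u =
     G\<lparr>verts := verts G - {u}, edges := edges G - {e},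
       ends := \<lambda>f. (\<lambda>x. if x = u then v else x) ` ends G f\<rparr>"

lemma delete_edge_simps [simp]:
  "verts (delete_edge G e) = verts G"
  "edges (delete_edge G e) = edges G - {e}"
  "ends (delete_edge G e) = ends G"
  "conn_rel (delete_edge G e) = conn_rel G"
  "num_components (delete_edge G e) = num_components G"
  by (auto simp: delete_edge_def conn_rel_def adj_rel_def num_components_def fun_eq_iff)

lemma contract_edge_simps [simp]:
  "verts (contract_edge G e v u) = verts G - {u}"
  "edges (contract_edge G e v u) = edges G - {e}"
  "ends (contract_edge G e v u) f = (\<lambda>x. if x = u then v else x) ` ends G f"
  by (auto simp: contract_edge_def)

lemma fin_multigraph_delete: "fin_multigraph G \<Longrightarrow> fin_multigraph (delete_edge G e)"
  by (auto simp: fin_multigraph_def)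

lemma card_1_2_iff: "card S \<in> {1, 2} \<longleftrightarrow> (\<exists>x y. S = {x, y})"
  by (auto simp: card_1_singleton_iff card_2_iff)

lemma fin_multigraph_contract:
  assumes "fin_multigraph G" "v \<in> verts G" "u \<noteq> v"
  shows "fin_multigraph (contract_edge G e v u)"
proof -
  have "\<exists>x y. (\<lambda>x. if x = u then v else x) ` S = {x, y}" if "\<exists>x y. S = {x, y}" for S
  proof -
    from that obtain x y where "S = {x, y}" by blast
    then have "(\<lambda>x. if x = u then v else x) ` S = {if x = u then v else x, if y = u then v else y}"
      by auto
    then show ?thesis by blast
  qed
  then show ?thesis
    using assms unfolding fin_multigraph_def card_1_2_iff by (auto simp: subset_iff)
qed

lemma adj_rel_insert:
  "ends G e = {u, v} \<Longrightarrow> adj_rel G (insert e Z) = insert (u, v) (insert (v, u) (adj_rel G Z))"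
  by (auto simp: adj_rel_def doubleton_eq_iff)

lemma conn_rel_insert:
  assumes "fin_multigraph G" "ends G e = {u, v}" "u \<in> verts G" "v \<in> verts G"
  shows "(x, y) \<in> conn_rel G (insert e Z) \<longleftrightarrow>
    (x, y) \<in> conn_rel G Z \<or> (x, u) \<in> conn_rel G Z \<and> (v, y) \<in> conn_rel G Z
      \<or> (x, v) \<in> conn_rel G Z \<and> (u, y) \<in> conn_rel G Z"
proof -
  have "sym ((adj_rel G Z)\<^sup>*)"
    by (intro sym_rtrancl symI) (auto simp: adj_rel_def insert_commute)
  then have s: "(p, q) \<in> (adj_rel G Z)\<^sup>* \<longleftrightarrow> (q, p) \<in> (adj_rel G Z)\<^sup>*" for p q
    by (blast dest: symD)
  have "(x, y) \<in> (adj_rel G (insert e Z))\<^sup>* \<longleftrightarrow>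
    (x, y) \<in> (adj_rel G Z)\<^sup>* \<or> (x, u) \<in> (adj_rel G Z)\<^sup>* \<and> (v, y) \<in> (adj_rel G Z)\<^sup>*
      \<or> (x, v) \<in> (adj_rel G Z)\<^sup>* \<and> (u, y) \<in> (adj_rel G Z)\<^sup>*"
    unfolding adj_rel_insert[of G, OF assms(2)] rtrancl_insert
    using s by (auto intro: rtrancl_trans)
  then show ?thesis using assms by (auto simp: conn_rel_def)
qed

lemma num_components_insert_connected:
  assumes "fin_multigraph G" "ends G e = {u, v}" "(u, v) \<in> conn_rel G Z"
  shows "num_components G (insert e Z) = num_components G Z"
proof -
  note eq = equiv_conn_rel[OF assms(1), of Z]
  have uv: "u \<in> verts G" "v \<in> verts G" using assms(3) by (auto simp: conn_rel_def)
  have sy: "(v, u) \<in> conn_rel G Z" using eq assms(3) by (meson equivE symD)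
  have tr: "(p, q) \<in> conn_rel G Z \<Longrightarrow> (q, s) \<in> conn_rel G Z \<Longrightarrow> (p, s) \<in> conn_rel G Z" for p q s
    using eq by (meson equivE transD)
  have "(x, y) \<in> conn_rel G (insert e Z) \<longleftrightarrow> (x, y) \<in> conn_rel G Z" for x y
    unfolding conn_rel_insert[OF assms(1,2) uv] using tr sy assms(3) by blast
  then have "conn_rel G (insert e Z) = conn_rel G Z" by (auto intro: set_eqI)
  then show ?thesis by (simp add: num_components_def)
qed

text \<open>
  The class of \<open>u\<close> and that of \<open>v\<close> are replaced by their union and all other classes persist, so the
  two quotients are written out as a common part plus two classes or one.
\<close>
lemma num_components_insert_separated:
  assumes "fin_multigraph G" "ends G e = {u, v}" "u \<in> verts G" "v \<in> verts G"
    and sep: "(u, v) \<notin> conn_rel G Z"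
  shows "num_components G Z = Suc (num_components G (insert e Z))"
proof -
  let ?R = "conn_rel G Z" and ?R' = "conn_rel G (insert e Z)" and ?V = "verts G"
  note eq = equiv_conn_rel[OF assms(1), of Z]
  have sy: "(p, q) \<in> ?R \<longleftrightarrow> (q, p) \<in> ?R" for p q
    using eq by (meson equivE symD)
  have tr: "(p, q) \<in> ?R \<Longrightarrow> (q, s) \<in> ?R \<Longrightarrow> (p, s) \<in> ?R" for p q s
    using eq by (meson equivE transD)
  have re: "p \<in> ?V \<Longrightarrow> (p, p) \<in> ?R" for p
    by (simp add: conn_rel_def)
  note ins = conn_rel_insert[OF assms(1-4)]
  let ?U = "?R `` {u}" and ?W = "?R `` {v}"
  have merged: "?R' `` {x} = ?U \<union> ?W" if "x \<in> ?U \<union> ?W" for x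
    using that sy tr by (auto simp: ins)
  have same: "?R' `` {x} = ?R `` {x}" if "x \<notin> ?U \<union> ?W" for x
    using that sy by (auto simp: ins)
  have cls: "?R `` {x} = ?U" if "x \<in> ?U" for x
    using that sy tr by blast
  have cls': "?R `` {x} = ?W" if "x \<in> ?W" for x
    using that sy tr by blast
  have u: "u \<in> ?U" and v: "v \<in> ?W" using re assms by auto
  have disj: "?U \<inter> ?W = {}" using sep sy tr by blast
  have Q: "?V // ?R = insert ?U (insert ?W ((\<lambda>x. ?R `` {x}) ` (?V - ?U - ?W)))"
    using assms(3,4) cls cls' by (auto simp: quotient_def image_iff)
  have Q': "?V // ?R' = insert (?U \<union> ?W) ((\<lambda>x. ?R `` {x}) ` (?V - ?U - ?W))"
  proof -
    have "?V // ?R' = (\<lambda>x. ?R' `` {x}) ` ((?U \<union> ?W) \<union> (?V - ?U - ?W))"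
      using assms(3,4) by (auto simp: quotient_def conn_rel_def)
    also have "\<dots> = (\<lambda>x. ?R' `` {x}) ` (?U \<union> ?W) \<union> (\<lambda>x. ?R `` {x}) ` (?V - ?U - ?W)"
      unfolding image_Un using same by (auto intro!: arg_cong2[of _ _ _ _ "(\<union>)"] image_cong)
    also have "(\<lambda>x. ?R' `` {x}) ` (?U \<union> ?W) = {?U \<union> ?W}"
      using merged u by (metis (no_types, lifting) UnI1 image_constant image_cong)
    finally show ?thesis by simp
  qed
  have fresh: "X \<inter> (?U \<union> ?W) = {}" if "X \<in> (\<lambda>x. ?R `` {x}) ` (?V - ?U - ?W)" for X
  proof -
    from that obtain x where x: "X = ?R `` {x}" "(u, x) \<notin> ?R" "(v, x) \<notin> ?R" by auto
    have "(u, y) \<notin> ?R \<and> (v, y) \<notin> ?R" if "(x, y) \<in> ?R" for y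
      using that x tr[of u y x] tr[of v y x] sy[of x y] by blast
    then show ?thesis using x(1) by auto
  qed
  have fin: "finite ((\<lambda>x. ?R `` {x}) ` (?V - ?U - ?W))"
    using assms(1) by (simp add: fin_multigraph_def)
  have "?U \<notin> insert ?W ((\<lambda>x. ?R `` {x}) ` (?V - ?U - ?W))"
    "?W \<notin> (\<lambda>x. ?R `` {x}) ` (?V - ?U - ?W)"
    "?U \<union> ?W \<notin> (\<lambda>x. ?R `` {x}) ` (?V - ?U - ?W)"
    using fresh u v disj by blast+
  then show ?thesis using fin by (simp add: num_components_def Q Q')
qed

text \<open>
  Each edge merges at most two components.  This makes the truncated subtraction in the exponents of
  the flow polynomial exact.
\<close>
lemma card_le_num_components:
  assumes "fin_multigraph G" "Z \<subseteq> edges G"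
  shows "card (verts G) \<le> card Z + num_components G Z"
proof -
  have "finite Z" using assms by (meson fin_multigraph_def finite_subset)
  then show ?thesis using assms(2)
  proof (induction Z)
    case empty
    have "adj_rel G {} = {}" by (simp add: adj_rel_def)
    then have "conn_rel G {} = Id_on (verts G)" by (auto simp: conn_rel_def)
    then have "verts G // conn_rel G {} = (\<lambda>x. {x}) ` verts G"
      by (auto simp: quotient_def)
    then show ?case by (simp add: num_components_def card_image)
  next
    case (insert e Z)
    then have e: "card (ends G e) \<in> {1, 2}" "ends G e \<subseteq> verts G"
      using assms(1) by (auto simp: fin_multigraph_def)
    then obtain u v where uv: "ends G e = {u, v}" unfolding card_1_2_iff by blast
    then have "u \<in> verts G" "v \<in> verts G" using e by auto
    then show ?case
      using num_components_insert_connected[OF assms(1) uv, of Z]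
        num_components_insert_separated[OF assms(1) uv, of Z] insert
      by (cases "(u, v) \<in> conn_rel G Z") auto
  qed
qed

text \<open>
  A walk in the contracted graph lifts to a walk in \<open>G\<close> that crosses \<open>e\<close> where necessary, and a walk
  in \<open>G\<close> is pushed down by renaming \<open>u\<close> to \<open>v\<close>.  Hence the components after contraction are the old
  ones without \<open>u\<close>.  None of them disappears or coincides with another one, since \<open>v\<close> lies in the
  component of \<open>u\<close>.
\<close>
lemma num_components_contract:
  assumes G: "fin_multigraph G" and e: "ends G e = {v, u}" "u \<noteq> v" "u \<in> verts G" "v \<in> verts G"
    and Z: "Z \<subseteq> edges G"
  shows "num_components (contract_edge G e v u) Z = num_components G (insert e Z)"
proof -
  let ?p = "\<lambda>x. if x = u then v else x" and ?H = "contract_edge G e v u"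
  let ?A = "adj_rel G (insert e Z)" and ?B = "adj_rel ?H Z"
  let ?R = "conn_rel G (insert e Z)" and ?S = "conn_rel ?H Z"
  note eq = equiv_conn_rel[OF G, of "insert e Z"]
  have up: "(x, ?p x) \<in> ?A\<^sup>*" "(?p x, x) \<in> ?A\<^sup>*" for x
    using e(1) by (auto simp: adj_rel_def insert_commute)
  have push: "(?p x, ?p y) \<in> ?B\<^sup>*" if "(x, y) \<in> ?A\<^sup>*" for x y
    using that
  proof induction
    case (step y z)
    have "(?p y, ?p z) \<in> ?B\<^sup>*"
    proof (cases "ends G e = {y, z}")
      case True
      then have "?p y = ?p z" using e(1) by (auto simp: doubleton_eq_iff)
      then show ?thesis by simp
    next
      case False
      then obtain f where "f \<in> Z" "ends G f = {y, z}"
        using step(2) unfolding adj_rel_def by blast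
      then have "ends ?H f = {?p y, ?p z}" by simp
      then have "(?p y, ?p z) \<in> ?B" using \<open>f \<in> Z\<close> unfolding adj_rel_def by blast
      then show ?thesis by (rule r_into_rtrancl)
    qed
    with step.IH show ?case by (rule rtrancl_trans)
  qed simp
  have 1: "(x, y) \<in> ?B\<^sup>*" if "(x, y) \<in> ?A\<^sup>*" "x \<noteq> u" "y \<noteq> u" for x y
    using push[OF that(1)] that(2,3) by simp
  have 2: "(x, y) \<in> ?A\<^sup>*" if "(x, y) \<in> ?B\<^sup>*" for x y
    using that
  proof induction
    case (step y z)
    from step(2) obtain f where f: "f \<in> Z" "?p ` ends G f = {y, z}"
      by (auto simp: adj_rel_def)
    then have "card (ends G f) \<in> {1, 2}" using G Z by (auto simp: fin_multigraph_def)
    then obtain a b where ab: "ends G f = {a, b}" unfolding card_1_2_iff by blast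
    have ends: "?p a = y \<and> ?p b = z \<or> ?p a = z \<and> ?p b = y"
      using f(2)[unfolded ab image_insert image_empty doubleton_eq_iff] .
    have "(a, b) \<in> ?A" "(b, a) \<in> ?A"
      using ab f(1) by (auto simp: adj_rel_def insert_commute)
    then have "(?p a, ?p b) \<in> ?A\<^sup>*" "(?p b, ?p a) \<in> ?A\<^sup>*"
      by (meson up rtrancl.rtrancl_into_rtrancl rtrancl_trans)+
    with ends have "(y, z) \<in> ?A\<^sup>*"
      by (elim disjE conjE) (simp_all only:)
    with step.IH show ?case by (rule rtrancl_trans)
  qed simp
  have S: "(x, y) \<in> ?S \<longleftrightarrow> (x, y) \<in> ?R \<and> x \<noteq> u \<and> y \<noteq> u" for x y
    using 1 2 by (auto simp: conn_rel_def)
  have vu: "(v, u) \<in> ?R" using up(1)[of u] up(2)[of u] e by (auto simp: conn_rel_def)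
  have v: "?R `` {u} = ?R `` {v}" using vu eq by (metis equiv_class_eq)
  have "verts G // ?R = (\<lambda>x. ?R `` {x}) ` (verts G - {u})"
    using v e by (auto simp: quotient_def)
  moreover have "verts ?H // ?S = (\<lambda>X. X - {u}) ` (\<lambda>x. ?R `` {x}) ` (verts G - {u})"
  proof -
    have "?S `` {x} = ?R `` {x} - {u}" if "x \<noteq> u" for x using that S by auto
    then show ?thesis by (auto simp: quotient_def image_image)
  qed
  moreover have "inj_on (\<lambda>X. X - {u}) (verts G // ?R)"
  proof (rule inj_onI)
    fix X Y assume XY: "X \<in> verts G // ?R" "Y \<in> verts G // ?R" "X - {u} = Y - {u}"
    have "X - {u} \<noteq> {}"
    proof -
      obtain x where x: "x \<in> verts G" "X = ?R `` {x}" using XY(1) by (auto elim: quotientE)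
      show ?thesis
      proof (cases "x = u")
        case True
        then have "v \<in> X" using x v e by (auto simp: conn_rel_def)
        then show ?thesis using e by auto
      next
        case False
        then show ?thesis using x by (auto simp: conn_rel_def)
      qed
    qed
    then show "X = Y" using XY quotient_disj[OF eq XY(1,2)] by blast
  qed
  ultimately show ?thesis by (simp add: num_components_def card_image)
qed

lemma connected_graph_iff:
  assumes "fin_multigraph G"
  shows "connected_graph G \<longleftrightarrow> num_components G (edges G) = 1"
proof -
  let ?R = "conn_rel G (edges G)"
  note eq = equiv_conn_rel[OF assms, of "edges G"]
  have fin: "finite (verts G)" using assms by (simp add: fin_multigraph_def)
  show ?thesis
  proof
    assume "connected_graph G"
    then have "verts G // ?R = {verts G}"
      by (auto simp: connected_graph_def quotient_def conn_rel_def)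
    then show "num_components G (edges G) = 1" by (simp add: num_components_def)
  next
    assume "num_components G (edges G) = 1"
    then obtain X where X: "verts G // ?R = {X}"
      by (auto simp: num_components_def card_1_singleton_iff)
    have same: "?R `` {x} = X" if "x \<in> verts G" for x
      using quotientI[OF that, of ?R] X by simp
    have "(x, y) \<in> ?R" if "x \<in> verts G" "y \<in> verts G" for x y
      using same[OF that(1)] same[OF that(2)] eq_equiv_class[OF _ eq that(2)] by simp
    moreover have "verts G \<noteq> {}" using X by (auto simp: quotient_def)
    ultimately show "connected_graph G" by (simp add: connected_graph_def)
  qed
qed

section \<open>Recursion for the flow polynomial\<close>

text \<open>
  The common source of the three reductions below: the edge sets avoiding \<open>e\<close> contribute the flow
  polynomial of \<open>G - e\<close> with the opposite sign.  The remaining sum depends on \<open>e\<close> only through the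
  number of components that arise when \<open>e\<close> is added.
\<close>
lemma flow_poly_split:
  assumes "fin_multigraph G" "e \<in> edges G"
  shows "flow_poly G =
    (\<Sum>Z \<in> Pow (edges G - {e}). monom ((-1) ^ (card (edges G - {e}) - card Z))
        (Suc (card Z + num_components G (insert e Z)) - card (verts G)))
    - flow_poly (delete_edge G e)"
proof -
  let ?E = "edges G - {e}"
  let ?t = "\<lambda>Z. monom ((-1) ^ (card (edges G) - card Z) :: int)
              (card Z + num_components G Z - card (verts G))"
  have fin: "finite ?E" using assms by (simp add: fin_multigraph_def)
  have cE: "card (edges G) = Suc (card ?E)"
    using assms by (metis card_Suc_Diff1 fin_multigraph_def)
  have E: "edges G = insert e ?E" using assms by auto
  have "flow_poly G = (\<Sum>Z \<in> Pow ?E \<union> insert e ` Pow ?E. ?t Z)"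
    unfolding flow_poly_def using E by (metis Pow_insert)
  also have "\<dots> = (\<Sum>Z \<in> Pow ?E. ?t Z) + (\<Sum>Z \<in> insert e ` Pow ?E. ?t Z)"
    using fin by (intro sum.union_disjoint) auto
  also have "(\<Sum>Z \<in> insert e ` Pow ?E. ?t Z) = (\<Sum>Z \<in> Pow ?E. ?t (insert e Z))"
    by (intro sum.reindex_cong[of "insert e"] refl) (auto simp: inj_on_def)
  also have "\<dots> = (\<Sum>Z \<in> Pow ?E. monom ((-1) ^ (card ?E - card Z))
        (Suc (card Z + num_components G (insert e Z)) - card (verts G)))"
  proof (rule sum.cong)
    fix Z assume Z: "Z \<in> Pow ?E"
    then have "finite Z" "e \<notin> Z" using fin by (auto dest: finite_subset)
    then show "?t (insert e Z) = monom ((-1) ^ (card ?E - card Z))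
        (Suc (card Z + num_components G (insert e Z)) - card (verts G))"
      by (simp add: cE)
  qed simp
  also have "(\<Sum>Z \<in> Pow ?E. ?t Z) = - flow_poly (delete_edge G e)"
    unfolding flow_poly_def sum_negf[symmetric]
  proof (rule sum.cong)
    fix Z assume Z: "Z \<in> Pow (edges (delete_edge G e))"
    then have "card Z \<le> card ?E" using fin by (auto intro: card_mono)
    then show "?t Z = - monom ((-1) ^ (card (edges (delete_edge G e)) - card Z))
       (card Z + num_components (delete_edge G e) Z - card (verts (delete_edge G e)))"
      by (simp add: cE Suc_diff_le minus_monom)
  qed simp
  finally show ?thesis by simp
qed

lemma flow_poly_loop:
  assumes "fin_multigraph G" "e \<in> edges G" "ends G e = {v}"
  shows "flow_poly G = [:-1, 1:] * flow_poly (delete_edge G e)"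
proof -
  have v: "v \<in> verts G" using assms by (auto simp: fin_multigraph_def)
  have "(\<Sum>Z \<in> Pow (edges G - {e}). monom ((-1) ^ (card (edges G - {e}) - card Z) :: int)
        (Suc (card Z + num_components G (insert e Z)) - card (verts G)))
    = monom 1 1 * flow_poly (delete_edge G e)"
    unfolding flow_poly_def sum_distrib_left
  proof (rule sum.cong)
    fix Z assume "Z \<in> Pow (edges (delete_edge G e))"
    then have "card (verts G) \<le> card Z + num_components G Z"
      by (intro card_le_num_components assms(1)) auto
    moreover have "num_components G (insert e Z) = num_components G Z"
      using assms v by (intro num_components_insert_connected[of _ _ v v]) (auto simp: conn_rel_def)
    ultimately show "monom ((-1) ^ (card (edges G - {e}) - card Z) :: int)
        (Suc (card Z + num_components G (insert e Z)) - card (verts G)) =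
      monom 1 1 * monom ((-1) ^ (card (edges (delete_edge G e)) - card Z))
       (card Z + num_components (delete_edge G e) Z - card (verts (delete_edge G e)))"
      by (simp add: mult_monom Suc_diff_le)
  qed simp
  moreover have "[:-1, 1:] = monom 1 1 - (1 :: int poly)"
    by (simp add: monom_Suc one_pCons)
  ultimately show ?thesis
    using flow_poly_split[OF assms(1,2)] by (simp only: left_diff_distrib mult_1)
qed

lemma flow_poly_contract:
  assumes "fin_multigraph G" "e \<in> edges G" "ends G e = {v, u}" "u \<noteq> v"
  shows "flow_poly G = flow_poly (contract_edge G e v u) - flow_poly (delete_edge G e)"
proof -
  have uv: "u \<in> verts G" "v \<in> verts G" using assms by (auto simp: fin_multigraph_def)
  have n: "card (verts G) = Suc (card (verts G - {u}))"
    using assms uv by (metis card_Suc_Diff1 fin_multigraph_def)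
  have "num_components (contract_edge G e v u) Z = num_components G (insert e Z)"
    if "Z \<in> Pow (edges G - {e})" for Z
    using that assms uv by (intro num_components_contract) auto
  then have "flow_poly (contract_edge G e v u) =
    (\<Sum>Z \<in> Pow (edges G - {e}). monom ((-1) ^ (card (edges G - {e}) - card Z))
        (Suc (card Z + num_components G (insert e Z)) - card (verts G)))"
    unfolding flow_poly_def contract_edge_simps n diff_Suc_Suc by (intro sum.cong) simp_all
  then show ?thesis
    using flow_poly_split[OF assms(1,2)] by (simp only:)
qed

text \<open>
  A bridge joins two different components of every spanning subgraph that avoids it.  Adding it
  therefore leaves the exponent unchanged and reverses the sign, and everything cancels.
\<close>
lemma flow_poly_bridge:
  assumes "fin_multigraph G" "connected_graph G" "e \<in> edges G" "\<not> connected_graph (delete_edge G e)"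
  shows "flow_poly G = 0"
proof -
  have "card (ends G e) \<in> {1, 2}" "ends G e \<subseteq> verts G"
    using assms by (auto simp: fin_multigraph_def)
  then obtain u v where e: "ends G e = {u, v}" "u \<in> verts G" "v \<in> verts G"
    unfolding card_1_2_iff by blast
  have sep: "(u, v) \<notin> conn_rel G Z" if Z: "Z \<subseteq> edges G - {e}" for Z
  proof
    assume "(u, v) \<in> conn_rel G Z"
    moreover have "(adj_rel G Z)\<^sup>* \<subseteq> (adj_rel G (edges G - {e}))\<^sup>*"
      using Z by (intro rtrancl_mono) (auto simp: adj_rel_def)
    ultimately have "(u, v) \<in> conn_rel G (edges G - {e})"
      by (auto simp: conn_rel_def)
    then have "num_components G (insert e (edges G - {e})) = num_components G (edges G - {e})"
      by (rule num_components_insert_connected[OF assms(1) e(1)])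
    then have "num_components G (edges G - {e}) = 1"
      using assms(2,3) connected_graph_iff[OF assms(1)] by (simp add: insert_absorb)
    then show False
      using assms(4) connected_graph_iff[OF fin_multigraph_delete[OF assms(1)], of e] by simp
  qed
  have "num_components G Z = Suc (num_components G (insert e Z))" if "Z \<in> Pow (edges G - {e})" for Z
    using that sep by (intro num_components_insert_separated[OF assms(1) e]) auto
  then show ?thesis
    unfolding flow_poly_split[OF assms(1,3)] by (simp add: flow_poly_def)
qed

section \<open>Degrees and the induction on graphs\<close>

definition incidence :: "('v, 'e) multigraph \<Rightarrow> 'v \<Rightarrow> 'e \<Rightarrow> nat" where
  "incidence G v e = (if ends G e = {v} then 2 else if v \<in> ends G e then 1 else 0)"

definition degree_at :: "('v, 'e) multigraph \<Rightarrow> 'v \<Rightarrow> nat" where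
  "degree_at G v = (\<Sum>e \<in> edges G. incidence G v e)"

lemma incidence_delete [simp]: "incidence (delete_edge G e) = incidence G"
  unfolding incidence_def delete_edge_simps ..

lemma degree_at_delete:
  assumes "fin_multigraph G" "e \<in> edges G"
  shows "degree_at G v = incidence G v e + degree_at (delete_edge G e) v"
  using assms by (simp add: degree_at_def fin_multigraph_def sum.remove)

text \<open>
  An edge keeps its total incidence with \<open>u\<close> and \<open>v\<close> when the two are identified; an edge parallel
  to \<open>e\<close> becomes a loop, which counts twice.  The 2 accounts for the two ends of \<open>e\<close> itself.
\<close>
lemma degree_at_contract:
  assumes "fin_multigraph G" "e \<in> edges G" "ends G e = {v, u}" "u \<noteq> v"
  shows "degree_at (contract_edge G e v u) v + 2 = degree_at G v + degree_at G u"
proof -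
  have "incidence (contract_edge G e v u) v f = incidence G v f + incidence G u f"
    if f: "f \<in> edges G - {e}" for f
  proof -
    have "card (ends G f) \<in> {1, 2}" using f assms(1) by (auto simp: fin_multigraph_def)
    then obtain x y where "ends G f = {x, y}" unfolding card_1_2_iff by blast
    then show ?thesis using assms(4) by (auto simp: incidence_def doubleton_eq_iff)
  qed
  then have "degree_at (contract_edge G e v u) v =
      degree_at (delete_edge G e) v + degree_at (delete_edge G e) u"
    by (simp add: degree_at_def sum.distrib)
  moreover have "incidence G v e = 1" "incidence G u e = 1"
    using assms(3,4) by (auto simp: incidence_def)
  ultimately show ?thesis
    using degree_at_delete[OF assms(1,2), of v] degree_at_delete[OF assms(1,2), of u] by simp
qed

lemma connected_isolated:
  assumes "fin_multigraph G" "connected_graph G" "v \<in> verts G" "degree_at G v = 0"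
  shows "verts G = {v}" "edges G = {}"
proof -
  have none: "v \<notin> ends G e" if "e \<in> edges G" for e
    using assms(1,4) that by (auto simp: degree_at_def incidence_def fin_multigraph_def split: if_splits)
  show V: "verts G = {v}"
  proof (rule ccontr)
    assume "verts G \<noteq> {v}"
    then obtain w where w: "w \<in> verts G" "w \<noteq> v" using assms(3) by auto
    then have "(v, w) \<in> (adj_rel G (edges G))\<^sup>*"
      using assms(2,3) by (auto simp: connected_graph_def conn_rel_def)
    then obtain x where "(v, x) \<in> adj_rel G (edges G)" using w by (metis converse_rtranclE)
    then show False using none by (auto simp: adj_rel_def)
  qed
  show "edges G = {}"
  proof (rule ccontr)
    assume "edges G \<noteq> {}"
    then obtain e where "e \<in> edges G" by blast
    then have "ends G e \<subseteq> {v}" "ends G e \<noteq> {}" "v \<notin> ends G e"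
      using assms(1) none V by (auto simp: fin_multigraph_def)
    then show False by auto
  qed
qed

text \<open>
  The hypothesis is used for \<open>G - e\<close> at both ends of the link: at \<open>v\<close> to get the summand with degree
  \<open>a - 1\<close>, and at \<open>u\<close> to see that \<open>F(G-e)\<close> vanishes when \<open>u\<close> has only one edge left.  This is why the
  statement has to hold for an arbitrary vertex.
\<close>
lemma flow_poly_dominated:
  assumes "fin_multigraph G" "connected_graph G" "v \<in> verts G"
  shows "flow_poly G \<preceq> flow_bound (card (edges G) + 1 - card (verts G)) (degree_at G v)"
  using assms
proof (induction "card (edges G)" arbitrary: G v rule: less_induct)
  case less
  note G = less.prems(1) and conn = less.prems(2) and v = less.prems(3)
  let ?m = "card (edges G)" and ?n = "card (verts G)" and ?a = "degree_at G v"
  let ?r = "?m + 1 - ?n"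
  have fin: "finite (edges G)" "finite (verts G)" using G by (auto simp: fin_multigraph_def)
  consider (isolated) "?a = 0"
    | (loop) e where "e \<in> edges G" "ends G e = {v}"
    | (link) e u where "e \<in> edges G" "ends G e = {v, u}" "u \<noteq> v"
  proof (cases "?a = 0")
    case False
    then obtain e where "e \<in> edges G" "incidence G v e \<noteq> 0"
      unfolding degree_at_def by (meson sum.neutral)
    then have e: "e \<in> edges G" "v \<in> ends G e"
      by (auto simp: incidence_def split: if_splits)
    then have "card (ends G e) \<in> {1, 2}" using G by (auto simp: fin_multigraph_def)
    then obtain u where "ends G e = {v, u}"
      using e(2) unfolding card_1_2_iff by (metis insertE insert_commute singletonD)
    then show thesis using that(2,3) e(1) by (cases "u = v") auto
  qed
  then show ?case
  proof cases
    case isolated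
    note single = connected_isolated[OF G conn v isolated]
    have "num_components G {} = 1" using conn connected_graph_iff[OF G] single by simp
    then have "flow_poly G = 1" using single by (simp add: flow_poly_def)
    moreover have "flow_bound ?r ?a = 1" using single isolated flow_bound_top[of 0] by simp
    ultimately show ?thesis by (auto simp: one_pCons intro!: dominated_explicit)
  next
    case loop
    let ?D = "delete_edge G e"
    have m: "?m = Suc (card (edges ?D))" using card.remove[OF fin(1) loop(1)] by (simp only: delete_edge_simps)
    have "num_components G (insert e (edges G - {e})) = num_components G (edges G - {e})"
      using G loop v by (intro num_components_insert_connected[of _ _ v v]) (auto simp: conn_rel_def)
    then have connD: "connected_graph ?D"
      using conn G loop by (simp add: connected_graph_iff fin_multigraph_delete insert_absorb)
    have "?n \<le> card (edges ?D) + num_components ?D (edges ?D)"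
      using card_le_num_components[OF G, of "edges ?D"] by simp
    then have n: "?n \<le> card (edges ?D) + 1"
      using connD G by (simp add: connected_graph_iff fin_multigraph_delete)
    have a: "?a = 2 + degree_at ?D v"
      using degree_at_delete[OF G loop(1), of v] loop by (simp add: incidence_def)
    have less: "card (edges ?D) < ?m" using m by linarith
    have rank: "card (edges ?D) + 1 - ?n = ?r - 1"
      using m by linarith
    have "flow_poly ?D \<preceq> flow_bound (?r - 1) (degree_at ?D v)"
      using less.hyps[OF less fin_multigraph_delete[OF G] connD, of v] v
      unfolding rank delete_edge_simps(1) by blast
    moreover have "degree_at ?D v = ?a - 2" using a by linarith
    ultimately have "flow_poly ?D \<preceq> flow_bound (?r - 1) (?a - 2)" by (simp only:)
    then have "flow_poly G \<preceq> [:1, 1:] * flow_bound (?r - 1) (?a - 2)"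
      unfolding flow_poly_loop[OF G loop]
      by (intro dominated_mult dominated_explicit) auto
    also have "\<dots> \<preceq> flow_bound ?r ?a" using a m n by (intro flow_bound_loop) linarith+
    finally show ?thesis .
  next
    case link
    let ?D = "delete_edge G e" and ?C = "contract_edge G e v u"
    have u: "u \<in> verts G" using G link by (auto simp: fin_multigraph_def)
    show ?thesis
    proof (cases "connected_graph ?D")
      case False
      then show ?thesis
        using flow_poly_bridge[OF G conn link(1)] by (simp add: zero_dominated flow_bound_nonneg)
    next
      case connD: True
      have GD: "fin_multigraph ?D" and GC: "fin_multigraph ?C"
        using G v link by (auto intro: fin_multigraph_delete fin_multigraph_contract)
      have m: "?m = Suc (card (edges ?D))" "?m = Suc (card (edges ?C))"
        using card.remove[OF fin(1) link(1)] by (simp_all only: delete_edge_simps contract_edge_simps)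
      have n: "?n = Suc (card (verts ?C))" using card.remove[OF fin(2) u] by (simp only: contract_edge_simps)
      have "num_components ?C (edges ?C) = num_components G (insert e (edges G - {e}))"
        using num_components_contract[OF G link(2,3) u v] by simp
      then have connC: "connected_graph ?C"
        using conn G GC link(1) by (simp add: connected_graph_iff insert_absorb)
      have av: "?a = 1 + degree_at ?D v" and au: "degree_at G u = 1 + degree_at ?D u"
        using degree_at_delete[OF G link(1)] link by (auto simp: incidence_def)
      have "degree_at ?D w \<noteq> 0" if "w \<in> {u, v}" for w
      proof
        assume "degree_at ?D w = 0"
        then have "verts G = {w}"
          using connected_isolated(1)[OF GD connD, of w] that u v by auto
        then show False using u v link(3) by simp
      qed
      then have pos: "degree_at ?D v \<ge> 1" "degree_at ?D u \<ge> 1"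
        by (simp_all add: Suc_le_eq)
      have aC: "degree_at ?C v + 2 = ?a + degree_at G u"
        by (rule degree_at_contract[OF G link])
      have less: "card (edges ?D) < ?m" "card (edges ?C) < ?m" using m by linarith+
      have rank: "card (edges ?C) + 1 - card (verts ?C) = ?r"
        "card (edges ?D) + 1 - ?n = ?r - 1"
        using m n by linarith+
      have "v \<in> verts ?C" using v link(3) by simp
      then have IHC: "flow_poly ?C \<preceq> flow_bound ?r (degree_at ?C v)"
        using less.hyps[OF less(2) GC connC, of v] unfolding rank by blast
      have IHD: "flow_poly ?D \<preceq> flow_bound (?r - 1) (degree_at ?D w)" if "w \<in> verts G" for w
        using less.hyps[OF less(1) GD connD, of w] that unfolding rank delete_edge_simps(1) by blast
      show ?thesis
      proof (cases "degree_at ?D u = 1")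
        case True
        then have "flow_poly ?D = 0"
          using IHD[OF u] by (simp add: flow_bound_1[simplified] dominated_zero_iff)
        moreover have "degree_at ?C v = ?a" using aC au True by simp
        ultimately show ?thesis using IHC by (simp add: flow_poly_contract[OF G link])
      next
        case False
        have "flow_poly G \<preceq> flow_bound ?r (degree_at ?C v) + flow_bound (?r - 1) (?a - 1)"
          unfolding flow_poly_contract[OF G link]
          using IHC IHD[OF v] av by (intro dominated_diff) auto
        also have "\<dots> \<preceq> flow_bound ?r (?a + 1) + flow_bound (?r - 1) (?a - 1)"
          using aC au av pos False by (intro dominated_add flow_bound_nonneg flow_bound_antimono) auto
        also have "\<dots> \<preceq> flow_bound ?r ?a"
          using flow_bound_step[of ?a ?r] av pos by (simp add: add.commute)
        finally show ?thesis .
      qed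
    qed
  qed
qed

theorem theorem1p2:
  fixes G :: "('v, 'e) multigraph" and n m i :: nat
  assumes "fin_multigraph G"
    and "card (verts G) = n" and "card (edges G) = m"
    and "connected_graph G" and "bridgeless G"
    and "m \<ge> n"
    and "i \<le> m - n + 1"
  shows "\<bar>coeff (flow_poly G) i\<bar> \<le> coeff (bound_poly n m) i"
proof -
  obtain v where "v \<in> verts G" using assms(4) by (auto simp: connected_graph_def)
  then have "flow_poly G \<preceq> flow_bound (m + 1 - n) (degree_at G v)"
    using flow_poly_dominated[OF assms(1,4)] assms(2,3) by simp
  also have "\<dots> \<preceq> bound_poly n m" using assms(6) by (rule flow_bound_le_bound_poly)
  finally show ?thesis by (simp add: dominated_def)
qed

end
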